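(* Let $S$ be a semiring and $M$ a totally ordered monoid. Then the following statements are equivalent: (1) For all $f$ and $g$ in $S[M]$, $\deg(f+g) = \max \{\deg(f),\deg(g)\}$. (2) The semiring $S$ is zerosumfree. (3) The semiring $S[M]$ is zerosumfree.
   Context: A semiring is a set $S$ with operations $+,\cdot$ such that $(S,+,0)$ and $(S,\cdot,1)$ are commutative monoids with $1\neq 0$, multiplication distributes over addition, and $s\cdot 0=0$ for all $s$. $S$ is zerosumfree if $a+b=0$ implies $a=b=0$ for all $a,b\in S$. A (commutative, additive) monoid $M$ is totally ordered if it carries a total order $<$ such that $a<b$ implies $a+c<b+c$ for all $a,b,c\in M$. $S[M]$ is the monoid semiring, whose elements are finite formal sums $\sum_i s_iX^{m_i}$ with $s_i\in S$, $m_i\in M$, and $X^mX^{m'}=X^{m+m'}$. The degree takes values in $M\cup\{-\infty\}$, where $-\infty<m$ for all $m\in M$: $\deg(0)=-\infty$, and if $f=\sum_{i=1}^n a_iX^{m_i}$ with all $a_i\ne0$ and $m_1<\dots<m_n$ ($n\ge1$), then $\deg(f)=m_n$. *)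

theory Defs
  imports "HOL-Library.Poly_Mapping" "HOL-Library.Option_ord"
begin

text \<open>
  Semirings are types of class \<^class>\<open>comm_semiring_1\<close>, and \<open>S[M]\<close> is the type \<open>'m \<Rightarrow>\<^sub>0 's\<close> of
  finitely supported functions with convolution product.

  The library's \<^class>\<open>linordered_cancel_ab_semigroup_add\<close> is deliberately not used: it presupposes
  a subtraction operation satisfying further axioms, which a totally ordered monoid need not have.
\<close>

class totally_ordered_monoid = comm_monoid_add + linorder +
  assumes add_less_add: "a < b \<Longrightarrow> a + c < b + c"

definition zerosumfree :: "'a::comm_semiring_1 itself \<Rightarrow> bool" where
  "zerosumfree _ \<longleftrightarrow> (\<forall>a b :: 'a. a + b = 0 \<longrightarrow> a = 0 \<and> b = 0)"

text \<open>
  \<open>M \<union> {-\<infinity>}\<close> is \<open>'m option\<close>, with \<^const>\<open>None\<close> as \<open>-\<infinity>\<close>; in the order on options used here,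
  \<^const>\<open>None\<close> lies strictly below every \<open>Some m\<close>.
\<close>

definition deg :: "('m::totally_ordered_monoid \<Rightarrow>\<^sub>0 's::comm_semiring_1) \<Rightarrow> 'm option" where
  "deg f = (if f = 0 then None else Some (Max (Poly_Mapping.keys f)))"

end

theory Submission
  imports Defs
begin

text \<open>The statements are linked in the cycle (2) to (1) to (3) to (2). If \<open>S\<close> is
  zerosumfree, coefficients cannot cancel, so the support of a sum is the union of the supports
  (\<open>keys_add_zerosumfree\<close>), and the maximum of a union is the larger of the two maxima.
  Conversely, the degree formula makes cancellation to zero impossible in \<open>S[M]\<close>,
  because only the zero element has degree -\<infinity>. Finally, \<open>S\<close> sits additively
  inside \<open>S[M]\<close> as the constants and inherits zerosumfreeness.\<close>

lemma keys_add_zerosumfree: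
  fixes f g :: "'m \<Rightarrow>\<^sub>0 's::comm_semiring_1"
  assumes "zerosumfree TYPE('s)"
  shows "Poly_Mapping.keys (f + g) = Poly_Mapping.keys f \<union> Poly_Mapping.keys g"
proof -
  have "a + b = 0 \<longleftrightarrow> a = 0 \<and> b = 0" for a b :: 's
    using assms unfolding zerosumfree_def by (metis add_0)
  then show ?thesis
    by (auto simp: in_keys_iff lookup_add)
qed

lemma deg_eq_None_iff: "deg f = None \<longleftrightarrow> f = 0"
  by (simp add: deg_def)

lemma deg_add_zerosumfree:
  fixes f g :: "'m::totally_ordered_monoid \<Rightarrow>\<^sub>0 's::comm_semiring_1"
  assumes "zerosumfree TYPE('s)"
  shows "deg (f + g) = max (deg f) (deg g)"
\<comment> \<open>The zero element is split off because \<open>Max\<close> says nothing useful about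
  an empty support; there \<open>None\<close>, the least element, is neutral for
  \<open>max\<close>.\<close>
proof (cases "f = 0 \<or> g = 0")
  case True
  then show ?thesis
    by (auto simp: deg_def max_def)
next
  case False
  then have ne: "Poly_Mapping.keys f \<noteq> {}" "Poly_Mapping.keys g \<noteq> {}"
    by auto
  note keys = keys_add_zerosumfree[OF assms, of f g]
  \<comment> \<open>The support of the sum contains the nonempty support of
    \<open>f\<close>.\<close>
  have "f + g \<noteq> 0"
    using ne keys by force
  moreover have "Max (Poly_Mapping.keys (f + g)) =
      max (Max (Poly_Mapping.keys f)) (Max (Poly_Mapping.keys g))"
    unfolding keys using ne by (intro Max_Un) auto
  ultimately show ?thesis
    using False by (simp add: deg_def max_def)
qed

lemma zerosumfree_poly_mapping_if_deg_add:
  assumes "\<And>f g :: 'm::totally_ordered_monoid \<Rightarrow>\<^sub>0 's::comm_semiring_1.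
    deg (f + g) = max (deg f) (deg g)"
  shows "zerosumfree TYPE('m \<Rightarrow>\<^sub>0 's)"
  unfolding zerosumfree_def
proof (intro allI impI)
  fix f g :: "'m \<Rightarrow>\<^sub>0 's"
  assume "f + g = 0"
  then have "max (deg f) (deg g) = None"
    by (metis assms deg_eq_None_iff)
  \<comment> \<open>\<open>None\<close> lies below every \<open>Some m\<close>, so a maximum equals
    \<open>None\<close> only if both arguments do.\<close>
  then have "deg f = None \<and> deg g = None"
    by (cases "deg f"; cases "deg g") (auto simp: max_def split: if_splits)
  then show "f = 0 \<and> g = 0"
    by (simp add: deg_eq_None_iff)
qed

lemma zerosumfree_coefficients:
  assumes "zerosumfree TYPE('m::comm_monoid_add \<Rightarrow>\<^sub>0 's::comm_semiring_1)"
  shows "zerosumfree TYPE('s)"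
  unfolding zerosumfree_def
proof (intro allI impI)
  fix a b :: 's
  assume "a + b = 0"
  \<comment> \<open>The sum is transported to \<open>S[M]\<close> along the additive, injective map
    sending \<open>s\<close> to the constant \<open>s\<close> at exponent \<open>0\<close>.\<close>
  then have "Poly_Mapping.single (0::'m) a + Poly_Mapping.single 0 b = 0"
    by (metis single_add single_zero)
  then have "Poly_Mapping.single (0::'m) a = 0 \<and> Poly_Mapping.single (0::'m) b = 0"
    using assms unfolding zerosumfree_def by blast
  then show "a = 0 \<and> b = 0"
    by (metis lookup_single_eq lookup_zero)
qed

theorem theorem5p15:
  shows "((\<forall>f g :: 'm::totally_ordered_monoid \<Rightarrow>\<^sub>0 's::comm_semiring_1.
             deg (f + g) = max (deg f) (deg g))
           \<longleftrightarrow> zerosumfree TYPE('s))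
       \<and> (zerosumfree TYPE('s) \<longleftrightarrow> zerosumfree TYPE('m \<Rightarrow>\<^sub>0 's))"
  using deg_add_zerosumfree[where 'm = 'm and 's = 's]
    zerosumfree_poly_mapping_if_deg_add[where 'm = 'm and 's = 's]
    zerosumfree_coefficients[where 'm = 'm and 's = 's]
  by blast

end
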